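(* Real analytic functions on $\mathbb{R}^2/G$ are functions which depend only on the variable $q$. Real analytic functions on $\mathbb{R}^2/G'$ are even functions which depend only on the variable $q$.
   Context: $\mathbb{R}^2$ has coordinates $(p,q)$. $G\simeq\mathbb{Z}$ acts by $n\cdot(p,q)=(p+nq,q)$; $G'=\left\{\begin{pmatrix}1&n\\0&\epsilon\end{pmatrix}: n\in\mathbb{Z},\epsilon\in\{\pm1\}\right\}$ acts by $(n,\epsilon)\cdot(p,q)=(p+nq,\epsilon q)$. A real analytic function on $\mathbb{R}^2/G$ (resp. $\mathbb{R}^2/G'$) is a real analytic function on $\mathbb{R}^2$ that is $G$-invariant (resp. $G'$-invariant). *)

theory Defs
  imports "HOL-Analysis.Analysis"
begin

text \<open>
  The plane is \<^typ>\<open>real^2\<close>; the point \<open>(p, q)\<close> is \<open>vector [p, q]\<close>,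
  that is, \<open>p = x $ 1\<close> and \<open>q = x $ 2\<close>.
\<close>

text \<open>
  Around every point the function is the sum of a power series in two variables.
  The sum over all exponent pairs is unconditional, which for real terms means absolute
  convergence.
\<close>

definition real_analytic :: "(real^2 \<Rightarrow> real) \<Rightarrow> bool" where
  "real_analytic f \<longleftrightarrow>
     (\<forall>a. \<exists>(c :: nat \<Rightarrow> nat \<Rightarrow> real) r. r > 0 \<and>
        (\<forall>x \<in> ball a r.
           ((\<lambda>(i, j). c i j * (x $ 1 - a $ 1) ^ i * (x $ 2 - a $ 2) ^ j) has_sum f x) UNIV))"

definition act_G :: "int \<Rightarrow> real^2 \<Rightarrow> real^2" where
  "act_G n x = vector [x $ 1 + of_int n * x $ 2, x $ 2]"

definition G'_mat :: "int \<Rightarrow> int \<Rightarrow> real^2^2" where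
  "G'_mat n \<epsilon> = vector [vector [1, of_int n], vector [0, of_int \<epsilon>]]"

definition G' :: "(real^2^2) set" where
  "G' = {G'_mat n \<epsilon> | n \<epsilon>. \<epsilon> \<in> {1, -1}}"

lemma G'_mat_action:
  "G'_mat n \<epsilon> *v x = vector [x $ 1 + of_int n * x $ 2, of_int \<epsilon> * x $ 2]"
  by (simp add: G'_mat_def vec_eq_iff forall_2 matrix_vector_mult_def sum_2)

lemma act_G_eq: "act_G n x = G'_mat n 1 *v x"
  by (simp add: act_G_def G'_mat_action)

definition real_analytic_mod_G :: "(real^2 \<Rightarrow> real) \<Rightarrow> bool" where
  "real_analytic_mod_G f \<longleftrightarrow> real_analytic f \<and> (\<forall>n x. f (act_G n x) = f x)"

definition real_analytic_mod_G' :: "(real^2 \<Rightarrow> real) \<Rightarrow> bool" where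
  "real_analytic_mod_G' f \<longleftrightarrow> real_analytic f \<and> (\<forall>A \<in> G'. \<forall>x. f (A *v x) = f x)"

end

theory Submission
  imports Defs "HOL-Complex_Analysis.Cauchy_Integral_Formula"
begin

text \<open>
  For fixed \<open>p\<close> and \<open>t \<noteq> 0\<close>, the function \<open>q \<mapsto> f (p + t, q) - f (p, q)\<close> is analytic in \<open>q\<close>,
  and by invariance under \<open>(p, q) \<mapsto> (p + n q, q)\<close> it vanishes at every \<open>q = t / n\<close>.
  These zeros accumulate at \<open>0\<close>, so the function is identically zero.
\<close>

text \<open>The one-variable counterpart of \<open>real_analytic\<close>, stated with ordered
  \<open>sums\<close> because that is the form used by the library lemmas on power series.\<close>

definition power_series_everywhere :: "(real \<Rightarrow> real) \<Rightarrow> bool" where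
  "power_series_everywhere h \<longleftrightarrow>
     (\<forall>a. \<exists>c r. r > 0 \<and> (\<forall>x \<in> ball a r. (\<lambda>n. c n * (x - a) ^ n) sums h x))"

lemma power_series_everywhere_diff:
  assumes "power_series_everywhere g" "power_series_everywhere h"
  shows "power_series_everywhere (\<lambda>x. g x - h x)"
  unfolding power_series_everywhere_def
proof
  fix a
  obtain c r where c: "r > 0" "\<And>x. x \<in> ball a r \<Longrightarrow> (\<lambda>n. c n * (x - a) ^ n) sums g x"
    using assms(1) unfolding power_series_everywhere_def by meson
  obtain d s where d: "s > 0" "\<And>x. x \<in> ball a s \<Longrightarrow> (\<lambda>n. d n * (x - a) ^ n) sums h x"
    using assms(2) unfolding power_series_everywhere_def by meson
  have "(\<lambda>n. (c n - d n) * (x - a) ^ n) sums (g x - h x)" if "x \<in> ball a (min r s)" for x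
    using sums_diff[OF c(2) d(2), of x] that by (simp add: left_diff_distrib)
  then show "\<exists>c r. r > 0 \<and> (\<forall>x \<in> ball a r. (\<lambda>n. c n * (x - a) ^ n) sums (g x - h x))"
    using c(1) d(1) by (intro exI[of _ "\<lambda>n. c n - d n"] exI[of _ "min r s"]) auto
qed

text \<open>Local half of the identity theorem: a power series with a nonzero coefficient has no
  zeros in some punctured ball around its centre, so accumulating zeros kill every coefficient of
  the expansion at \<open>a\<close>.\<close>

lemma power_series_eventually_zero:
  assumes h: "power_series_everywhere h" and lim: "a islimpt {x. h x = 0}"
  shows "\<forall>\<^sub>F x in nhds a. h x = 0"
proof -
  obtain c r where r: "r > 0"
    and sums: "\<And>x. x \<in> ball a r \<Longrightarrow> (\<lambda>n. c n * (x - a) ^ n) sums h x"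
    using h unfolding power_series_everywhere_def by meson
  have sums': "(\<lambda>n. c n * x ^ n) sums h (x + a)" if "norm x < r" for x
    using sums[of "x + a"] that by (simp add: dist_norm)
  have freq: "\<exists>\<^sub>F x in at a. h x = 0"
    using lim by (simp add: islimpt_conv_frequently_at)
  have "((\<lambda>x. h (x + a)) \<longlongrightarrow> c 0) (at 0)"
    using r sums' by (rule powser_limit_0)
  then have tends: "(h \<longlongrightarrow> c 0) (at a)"
    by (simp add: LIM_offset_zero_iff add.commute)
  \<comment> \<open>A limit point of zeros is not yet a zero. A nonzero limit \<open>c 0\<close>
    would keep \<open>h\<close> away from 0 near \<open>a\<close>; once \<open>c 0 = 0\<close>, also
    \<open>h a = 0\<close>, which \<open>powser_0_nonzero\<close> requires.\<close>
  have c0: "c 0 = 0"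
  proof (rule ccontr)
    assume "c 0 \<noteq> 0"
    then have "\<forall>\<^sub>F x in at a. h x \<noteq> 0"
      using tends by (rule tendsto_imp_eventually_ne[rotated])
    with freq show False by (simp add: frequently_def)
  qed
  have ha: "h a = 0"
  proof -
    have "(\<lambda>n. c n * 0 ^ n) sums h a" using sums'[of 0] r by simp
    then show ?thesis using c0 powser_sums_zero_iff by metis
  qed
  have "c n = 0" for n
  proof (rule ccontr)
    assume "c n \<noteq> 0"
    with c0 have "n > 0" by (metis neq0_conv)
    obtain s where s: "s > 0" "\<And>z. z \<in> cball a s - {a} \<Longrightarrow> h z \<noteq> 0"
      by (rule powser_0_nonzero[of r a c h n])
        (use r sums ha \<open>c n \<noteq> 0\<close> \<open>n > 0\<close> in \<open>auto simp: dist_norm norm_minus_commute\<close>)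
    have "\<forall>\<^sub>F x in at a. h x \<noteq> 0"
      unfolding eventually_at using s by (intro exI[of _ s]) (auto simp: dist_commute)
    with freq show False by (simp add: frequently_def)
  qed
  then have "h x = 0" if "x \<in> ball a r" for x
    using sums[OF that] by (simp add: sums_iff)
  then show ?thesis
    unfolding eventually_nhds_metric using r by (auto simp: dist_commute)
qed

text \<open>Global half, by connectedness of the real line: the set \<open>Z\<close> of points near
  which \<open>h\<close> vanishes identically is open, closed and contains \<open>a\<close>.\<close>

lemma power_series_identity:
  assumes h: "power_series_everywhere h" and lim: "a islimpt {x. h x = 0}"
  shows "h x = 0"
proof -
  define Z where "Z = {x. \<forall>\<^sub>F y in nhds x. h y = 0}"
  have "open Z"
    unfolding Z_def by (subst open_subopen) (auto simp: eventually_nhds)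
  moreover have "closed Z"
    \<comment> \<open>A limit point of \<open>Z\<close> is a limit point of zeros of
      \<open>h\<close>, so the local lemma applies there.\<close>
    unfolding closed_limpt
  proof safe
    fix y assume "y islimpt Z"
    moreover have "Z \<subseteq> {x. h x = 0}"
      unfolding Z_def using eventually_nhds_x_imp_x by auto
    ultimately have "y islimpt {x. h x = 0}" by (rule islimpt_subset)
    then show "y \<in> Z" unfolding Z_def using power_series_eventually_zero[OF h] by simp
  qed
  moreover have "a \<in> Z"
    unfolding Z_def using power_series_eventually_zero[OF h lim] by simp
  ultimately have "Z = UNIV"
    using clopen[of Z] by auto
  then have "\<forall>\<^sub>F y in nhds x. h y = 0" unfolding Z_def by auto
  then show ?thesis by (rule eventually_nhds_x_imp_x)
qed

lemma real_analytic_slice: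
  assumes "real_analytic f"
  shows "power_series_everywhere (\<lambda>q. f (vector [p, q]))"
  unfolding power_series_everywhere_def
proof
  fix b
  define a :: "real^2" where "a = vector [p, b]"
  obtain c :: "nat \<Rightarrow> nat \<Rightarrow> real" and r where r: "r > 0" and
    hs: "\<And>x. x \<in> ball a r \<Longrightarrow>
      ((\<lambda>(i, j). c i j * (x $ 1 - a $ 1) ^ i * (x $ 2 - a $ 2) ^ j) has_sum f x) UNIV"
    using assms unfolding real_analytic_def by meson
  have "(\<lambda>j. c 0 j * (q - b) ^ j) sums f (vector [p, q])" if "q \<in> ball b r" for q
  proof -
    have "vector [p, q] \<in> ball a r"
      using that by (simp add: a_def dist_vec_def L2_set_def sum_2)
    from hs[OF this]
    have "((\<lambda>(i, j). c i j * 0 ^ i * (q - b) ^ j) has_sum f (vector [p, q])) UNIV"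
      by (simp add: a_def)
    \<comment> \<open>On the vertical line through the centre the factor \<open>0 ^ i\<close>
      removes all terms with i > 0, while \<open>0 ^ 0 = 1\<close> keeps the row i = 0, which is
      \<open>range (Pair 0)\<close>.\<close>
    then have "((\<lambda>(i, j). c i j * 0 ^ i * (q - b) ^ j) has_sum f (vector [p, q])) (range (Pair 0))"
      by (rule has_sum_cong_neutral[THEN iffD1, rotated -1]) (auto simp: image_iff)
    then have "((\<lambda>j. c 0 j * (q - b) ^ j) has_sum f (vector [p, q])) UNIV"
      by (subst (asm) has_sum_reindex) (auto simp: o_def inj_on_def)
    then show ?thesis by (rule has_sum_imp_sums)
  qed
  with r show "\<exists>c r. r > 0 \<and> (\<forall>q \<in> ball b r. (\<lambda>n. c n * (q - b) ^ n) sums f (vector [p, q]))"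
    by blast
qed

lemma real_analytic_mod_G_indep:
  assumes "real_analytic_mod_G f"
  shows "f (vector [p, q]) = f (vector [0, q])"
proof (cases "p = 0")
  case False
  define h where "h q = f (vector [p, q]) - f (vector [0, q])" for q
  have "power_series_everywhere h"
    unfolding h_def
    using assms by (intro power_series_everywhere_diff real_analytic_slice)
      (simp_all add: real_analytic_mod_G_def)
  moreover have "0 islimpt {q. h q = 0}"
    unfolding islimpt_sequential
  proof (intro exI conjI allI)
    \<comment> \<open>The element \<open>Suc n\<close> of G carries (0, p / \<open>Suc n\<close>) to
      (p, p / \<open>Suc n\<close>). Using \<open>Suc n\<close> avoids division by zero, and p
      \<noteq> 0 keeps these zeros of \<open>h\<close> apart from their limit 0.\<close>
    show "(\<lambda>n. p / real (Suc n)) \<longlonglongrightarrow> 0"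
      using LIMSEQ_Suc[OF lim_const_over_n] by simp
    fix n
    have "f (act_G (int (Suc n)) (vector [0, p / real (Suc n)])) = f (vector [0, p / real (Suc n)])"
      using assms unfolding real_analytic_mod_G_def by blast
    moreover have "act_G (int (Suc n)) (vector [0, p / real (Suc n)]) = vector [p, p / real (Suc n)]"
      by (simp add: act_G_def del: of_nat_Suc)
    ultimately show "p / real (Suc n) \<in> {q. h q = 0} - {0}"
      using False by (simp add: h_def)
  qed
  ultimately have "h q = 0" by (rule power_series_identity)
  then show ?thesis by (simp add: h_def)
qed simp

lemma vector_2_components: "vector [x $ 1, x $ 2] = (x :: real^2)"
  by (simp add: vec_eq_iff forall_2)

text \<open>The matrices with \<epsilon> = 1 are exactly the action of G; the second conjunct is
  invariance under those with \<epsilon> = -1.\<close>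

lemma real_analytic_mod_G'_iff:
  "real_analytic_mod_G' f \<longleftrightarrow>
     real_analytic_mod_G f \<and> (\<forall>n p q. f (vector [p + of_int n * q, - q]) = f (vector [p, q]))"
proof -
  have vec: "(\<forall>x. P x) \<longleftrightarrow> (\<forall>p q. P (vector [p, q]))" for P :: "real^2 \<Rightarrow> bool"
    by (metis vector_2_components)
  have "(\<forall>A \<in> G'. \<forall>x. f (A *v x) = f x) \<longleftrightarrow>
    (\<forall>n x. f (G'_mat n 1 *v x) = f x) \<and> (\<forall>n x. f (G'_mat n (- 1) *v x) = f x)"
    unfolding G'_def by blast
  then show ?thesis
    unfolding real_analytic_mod_G'_def real_analytic_mod_G_def act_G_eq
    by (auto simp: G'_mat_action vec)
qed

lemma real_analytic_mod_G_iff: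
  "real_analytic_mod_G f \<longleftrightarrow> real_analytic f \<and> (\<exists>g. \<forall>p q. f (vector [p, q]) = g q)"
proof
  assume f: "real_analytic_mod_G f"
  then have "\<exists>g. \<forall>p q. f (vector [p, q]) = g q"
    by (intro exI[of _ "\<lambda>q. f (vector [0, q])"] allI real_analytic_mod_G_indep)
  with f show "real_analytic f \<and> (\<exists>g. \<forall>p q. f (vector [p, q]) = g q)"
    by (simp add: real_analytic_mod_G_def)
next
  assume "real_analytic f \<and> (\<exists>g. \<forall>p q. f (vector [p, q]) = g q)"
  then obtain g where f: "real_analytic f" and g: "\<And>p q. f (vector [p, q]) = g q" by blast
  \<comment> \<open>For the converse it suffices that G fixes the second coordinate.\<close>
  have "f x = g (x $ 2)" for x
    by (metis g vector_2_components)
  with f show "real_analytic_mod_G f"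
    by (simp add: real_analytic_mod_G_def act_G_def)
qed

theorem corollary2p5:
  "{f. real_analytic_mod_G f} =
     {f. real_analytic f \<and> (\<exists>g :: real \<Rightarrow> real. \<forall>p q. f (vector [p, q]) = g q)} \<and>
   {f. real_analytic_mod_G' f} =
     {f. real_analytic f \<and>
         (\<exists>g :: real \<Rightarrow> real. (\<forall>q. g (- q) = g q) \<and> (\<forall>p q. f (vector [p, q]) = g q))}"
proof -
  \<comment> \<open>Once f depends on q alone, the shift by n q is invisible, and invariance under
    \<epsilon> = -1 says exactly that g is even.\<close>
  have "real_analytic_mod_G' f \<longleftrightarrow> real_analytic f \<and>
      (\<exists>g. (\<forall>q. g (- q) = g q) \<and> (\<forall>p q. f (vector [p, q]) = g q))" for f
    unfolding real_analytic_mod_G'_iff real_analytic_mod_G_iff by metis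
  then show ?thesis
    using real_analytic_mod_G_iff by simp
qed

end
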